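(* Let $d\in\mathbb{N}$ and let $\xi,\xi_1,\xi_2,\ldots$ be i.i.d. random variables in $\mathbb{R}^d$ with $\mathbb{E}\|\xi\|<\infty$ and $\mathbb{E}\xi=\mu$. Let $S_n:=\sum_{i=1}^n\xi_i$, $G_0:=0$ and $G_n:=\frac1n\sum_{i=1}^nS_i$ for $n\ge1$. Let $t\in[0,1]$. Then $$\frac1n G_{\lfloor nt\rfloor}\to\frac{\mu t}{2}\quad\text{almost surely, as }n\to\infty.$$ *)

theory Defs
  imports "HOL-Probability.Probability"
begin

definition walk :: "(nat \<Rightarrow> 'w \<Rightarrow> 'a::real_vector) \<Rightarrow> nat \<Rightarrow> 'w \<Rightarrow> 'a" where
  "walk X n \<omega> = (\<Sum>i = 1..n. X i \<omega>)"

definition center_of_mass :: "(nat \<Rightarrow> 'w \<Rightarrow> 'a::real_vector) \<Rightarrow> nat \<Rightarrow> 'w \<Rightarrow> 'a" where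
  "center_of_mass X n \<omega> =
     (if n = 0 then 0 else (1 / real n) *\<^sub>R (\<Sum>i = 1..n. walk X i \<omega>))"

end

theory Submission
  imports Defs
begin

text \<open>
  By Etemadi's argument, the strong law of large numbers gives \<open>S\<^sub>n / n \<rightarrow> \<mu>\<close> almost surely: for
  nonnegative variables and \<open>a > 1\<close>, truncate the first \<open>a\<^sup>n\<close> variables at the level \<open>a\<^sup>n\<close>.
  The variances of the normalised truncated sums are summable over \<open>n\<close>, and almost surely truncation
  eventually changes nothing, so the averages converge along \<open>a\<^sup>n\<close>; monotonicity of the partial sums
  fills the gaps up to a factor \<open>a\<close>, and \<open>a\<close> may be taken arbitrarily close to 1.
  The rest is deterministic: if \<open>S\<^sub>i = i \<mu> + o(i)\<close>, then \<open>G\<^sub>k = k \<mu> / 2 + o(k)\<close>,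
  which is used with \<open>k = \<lfloor>nt\<rfloor>\<close>.
\<close>

lemma truncated_geometric_sum_le:
  fixes y a :: real
  assumes a: "a > 1" and y: "y \<ge> 0"
  shows "(\<Sum>n<N. (if y \<le> a ^ n then y else 0)\<^sup>2 / a ^ n) \<le> a / (a - 1) * y"
  using y
proof (induction N arbitrary: y)
  case 0
  then show ?case using a by simp
next
  case (Suc N)
  show ?case
  proof (cases "y \<le> 1")
    case True
    have "(\<Sum>n<Suc N. (if y \<le> a ^ n then y else 0)\<^sup>2 / a ^ n) \<le> (\<Sum>n<Suc N. y * (1 / a) ^ n)"
    proof (rule sum_mono)
      fix n
      have "y\<^sup>2 \<le> y"
        using True Suc.prems by (simp add: power2_eq_square mult_left_le)
      then show "(if y \<le> a ^ n then y else 0)\<^sup>2 / a ^ n \<le> y * (1 / a) ^ n"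
        using a Suc.prems by (auto simp: power_one_over divide_simps)
    qed
    also have "\<dots> = y * (\<Sum>n<Suc N. (1 / a) ^ n)"
      by (rule sum_distrib_left[symmetric])
    also have "\<dots> \<le> y * (\<Sum>n. (1 / a) ^ n)"
      using a Suc.prems by (intro mult_left_mono sum_le_suminf summable_geometric) auto
    also have "\<dots> = a / (a - 1) * y"
      using a by (subst suminf_geometric) (auto simp: field_simps)
    finally show ?thesis .
  next
    case False
    have "(\<Sum>n<Suc N. (if y \<le> a ^ n then y else 0)\<^sup>2 / a ^ n)
        = (\<Sum>n<N. (if y \<le> a ^ Suc n then y else 0)\<^sup>2 / a ^ Suc n)"
      using False by (subst sum.lessThan_Suc_shift) simp
    also have "\<dots> = (\<Sum>n<N. a * ((if y / a \<le> a ^ n then y / a else 0)\<^sup>2 / a ^ n))"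
      using a by (intro sum.cong) (auto simp: field_simps power2_eq_square)
    also have "\<dots> = a * (\<Sum>n<N. (if y / a \<le> a ^ n then y / a else 0)\<^sup>2 / a ^ n)"
      by (simp add: sum_distrib_left)
    also have "\<dots> \<le> a * (a / (a - 1) * (y / a))"
      using a Suc.prems by (intro mult_left_mono Suc.IH) auto
    also have "\<dots> = a / (a - 1) * y"
      using a by simp
    finally show ?thesis .
  qed
qed

lemma count_exceeded_le:
  fixes y :: real
  assumes "y \<ge> 0"
  shows "(\<Sum>i<N. if real (Suc i) < y then 1 else 0) \<le> y"
proof -
  have "(\<Sum>i<N. if real (Suc i) < y then 1 else 0) \<le> min (real N) y"
    using assms by (induction N) auto
  then show ?thesis by simp
qed

lemma tendsto_average_if_geometric_subsequences:
  fixes S :: "nat \<Rightarrow> real" and c :: real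
  assumes "mono S" and nonneg: "\<And>n. S n \<ge> 0"
    and lim: "\<And>m. (\<lambda>n. S (nat \<lfloor>(1 + 1 / real (Suc m)) ^ n\<rfloor>) / (1 + 1 / real (Suc m)) ^ n) \<longlonglongrightarrow> c"
  shows "(\<lambda>n. S n / real n) \<longlonglongrightarrow> c"
proof -
  define a where "a m = 1 + 1 / real (Suc m)" for m
  have a: "a m > 1" for m by (simp add: a_def)
  have a_lim: "a \<longlonglongrightarrow> 1"
    unfolding a_def using LIMSEQ_inverse_real_of_nat_add[of 1] by (simp add: field_simps)
  have lim': "(\<lambda>n. S (nat \<lfloor>a m ^ n\<rfloor>) / a m ^ n) \<longlonglongrightarrow> c" for m
    using lim[of m] by (simp add: a_def)
  define j where "j m n = nat \<lfloor>log (a m) (real n)\<rfloor>" for m n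
  have j_lim: "filterlim (j m) at_top sequentially" for m
  proof -
    have "filterlim (\<lambda>n. ln (real n) * (1 / ln (a m))) at_top sequentially"
      using a[of m]
      by (intro filterlim_at_top_mult_tendsto_pos[OF tendsto_const]
          filterlim_compose[OF ln_at_top filterlim_real_sequentially]) auto
    then show ?thesis
      unfolding j_def log_def divide_inverse
      by (intro filterlim_compose[OF filterlim_nat_sequentially]
          filterlim_compose[OF filterlim_floor_sequentially]) simp
  qed
  have j_bounds: "a m ^ j m n \<le> real n \<and> real n < a m ^ Suc (j m n)" if "n \<ge> 1" for m n
  proof -
    have l: "0 \<le> log (a m) (real n)" using that a[of m] by (simp add: zero_le_log_cancel_iff)
    have "real (j m n) \<le> log (a m) (real n)" "log (a m) (real n) < real (Suc (j m n))"
      using l unfolding j_def by linarith+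
    then show ?thesis
      using a[of m] that by (simp add: le_log_iff log_less_iff powr_realpow del: power_Suc of_nat_Suc)
  qed
  have lower: "S (nat \<lfloor>a m ^ j m n\<rfloor>) / a m ^ j m n / a m \<le> S n / real n" if "n \<ge> 1" for m n
  proof -
    have "nat \<lfloor>a m ^ j m n\<rfloor> \<le> n" using j_bounds[OF that, of m] by linarith
    then have "S (nat \<lfloor>a m ^ j m n\<rfloor>) \<le> S n" by (rule monoD[OF \<open>mono S\<close>])
    then have "S (nat \<lfloor>a m ^ j m n\<rfloor>) / a m ^ Suc (j m n) \<le> S n / real n"
      using j_bounds[OF that, of m] nonneg that by (intro frac_le) auto
    then show ?thesis by (simp add: mult.commute)
  qed
  have upper: "S n / real n \<le> S (nat \<lfloor>a m ^ Suc (j m n)\<rfloor>) / a m ^ Suc (j m n) * a m" if "n \<ge> 1" for m n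
  proof -
    have "n \<le> nat \<lfloor>a m ^ Suc (j m n)\<rfloor>" using j_bounds[OF that, of m] by linarith
    then have "S n \<le> S (nat \<lfloor>a m ^ Suc (j m n)\<rfloor>)" by (rule monoD[OF \<open>mono S\<close>])
    then have "S n / real n \<le> S (nat \<lfloor>a m ^ Suc (j m n)\<rfloor>) / a m ^ j m n"
      using j_bounds[OF that, of m] nonneg that a[of m] by (intro frac_le) auto
    then show ?thesis using a[of m] by simp
  qed
  show ?thesis
  proof (rule order_tendstoI)
    fix l assume "l < c"
    have "(\<lambda>m. c / a m) \<longlonglongrightarrow> c / 1" by (intro tendsto_intros a_lim) auto
    then have "eventually (\<lambda>m. l < c / a m) sequentially"
      using \<open>l < c\<close> by (intro order_tendstoD) auto
    then obtain m where m: "l < c / a m" by (auto simp: eventually_sequentially)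
    have "(\<lambda>n. S (nat \<lfloor>a m ^ j m n\<rfloor>) / a m ^ j m n / a m) \<longlonglongrightarrow> c / a m"
      using a[of m] by (intro tendsto_divide filterlim_compose[OF lim' j_lim] tendsto_const) auto
    then have "eventually (\<lambda>n. l < S (nat \<lfloor>a m ^ j m n\<rfloor>) / a m ^ j m n / a m) sequentially"
      using m by (intro order_tendstoD)
    then show "eventually (\<lambda>n. l < S n / real n) sequentially"
      using eventually_ge_at_top[of 1] by eventually_elim (use lower less_le_trans in blast)
  next
    fix u assume "c < u"
    have "(\<lambda>m. c * a m) \<longlonglongrightarrow> c * 1" by (intro tendsto_intros a_lim)
    then have "eventually (\<lambda>m. c * a m < u) sequentially"
      using \<open>c < u\<close> by (intro order_tendstoD) auto
    then obtain m where m: "c * a m < u" by (auto simp: eventually_sequentially)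
    have "(\<lambda>n. S (nat \<lfloor>a m ^ Suc (j m n)\<rfloor>) / a m ^ Suc (j m n) * a m) \<longlonglongrightarrow> c * a m"
      by (intro tendsto_mult filterlim_compose[OF lim'] filterlim_compose[OF filterlim_Suc j_lim]
          tendsto_const)
    then have "eventually (\<lambda>n. S (nat \<lfloor>a m ^ Suc (j m n)\<rfloor>) / a m ^ Suc (j m n) * a m < u) sequentially"
      using m by (intro order_tendstoD)
    then show "eventually (\<lambda>n. S n / real n < u) sequentially"
      using eventually_ge_at_top[of 1] by eventually_elim (use upper le_less_trans in blast)
  qed
qed

lemma AE_tendsto_0_if_dominated_sums:
  fixes g h :: "nat \<Rightarrow> 'w \<Rightarrow> real" and H :: "'w \<Rightarrow> real"
  assumes [measurable]: "\<And>n. g n \<in> borel_measurable M" "\<And>n. h n \<in> borel_measurable M"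
    and g: "\<And>n \<omega>. g n \<omega> \<ge> 0" and h: "\<And>n \<omega>. h n \<omega> \<ge> 0"
    and le: "\<And>n. (\<integral>\<^sup>+\<omega>. g n \<omega> \<partial>M) \<le> (\<integral>\<^sup>+\<omega>. h n \<omega> \<partial>M)"
    and H: "integrable M H" "\<And>N \<omega>. (\<Sum>n<N. h n \<omega>) \<le> H \<omega>"
  shows "AE \<omega> in M. (\<lambda>n. g n \<omega>) \<longlonglongrightarrow> 0"
proof -
  have "(\<integral>\<^sup>+\<omega>. (\<Sum>n. ennreal (g n \<omega>)) \<partial>M) = (\<Sum>n. \<integral>\<^sup>+\<omega>. g n \<omega> \<partial>M)"
    by (rule nn_integral_suminf) simp
  also have "\<dots> \<le> (\<Sum>n. \<integral>\<^sup>+\<omega>. h n \<omega> \<partial>M)"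
    by (intro suminf_le le) auto
  also have "\<dots> = (\<integral>\<^sup>+\<omega>. (\<Sum>n. ennreal (h n \<omega>)) \<partial>M)"
    by (rule nn_integral_suminf[symmetric]) simp
  also have "\<dots> \<le> (\<integral>\<^sup>+\<omega>. ennreal (H \<omega>) \<partial>M)"
    by (intro nn_integral_mono suminf_le_const) (auto simp: h H(2) intro: ennreal_leI)
  also have "\<dots> \<le> (\<integral>\<^sup>+\<omega>. ennreal (norm (H \<omega>)) \<partial>M)"
    by (intro nn_integral_mono ennreal_leI) simp
  also have "\<dots> < \<infinity>"
    using H(1) by (simp add: integrable_iff_bounded)
  finally have "(\<integral>\<^sup>+\<omega>. (\<Sum>n. ennreal (g n \<omega>)) \<partial>M) \<noteq> \<infinity>" by simp
  then have "AE \<omega> in M. (\<Sum>n. ennreal (g n \<omega>)) \<noteq> \<infinity>"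
    by (intro nn_integral_PInf_AE) auto
  then show ?thesis
    by eventually_elim (auto intro!: summable_LIMSEQ_zero summable_suminf_not_top g)
qed

lemma (in prob_space) expectation_sum_squared_indep:
  fixes Z :: "'i \<Rightarrow> 'a \<Rightarrow> real"
  assumes "finite I" and indep: "indep_vars (\<lambda>_. borel) Z I"
    and int: "\<And>i. i \<in> I \<Longrightarrow> integrable M (Z i)" "\<And>i. i \<in> I \<Longrightarrow> integrable M (\<lambda>\<omega>. (Z i \<omega>)\<^sup>2)"
    and mean: "\<And>i. i \<in> I \<Longrightarrow> expectation (Z i) = 0"
  shows "integrable M (\<lambda>\<omega>. (\<Sum>i\<in>I. Z i \<omega>)\<^sup>2)"
    and "expectation (\<lambda>\<omega>. (\<Sum>i\<in>I. Z i \<omega>)\<^sup>2) = (\<Sum>i\<in>I. expectation (\<lambda>\<omega>. (Z i \<omega>)\<^sup>2))"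
proof -
  have prod: "integrable M (\<lambda>\<omega>. Z i \<omega> * Z j \<omega>) \<and>
      expectation (\<lambda>\<omega>. Z i \<omega> * Z j \<omega>) = (if i = j then expectation (\<lambda>\<omega>. (Z i \<omega>)\<^sup>2) else 0)"
    if ij: "i \<in> I" "j \<in> I" for i j
  proof (cases "i = j")
    case True
    then show ?thesis using int(2)[OF ij(1)] by (simp add: power2_eq_square)
  next
    case False
    have ind: "indep_vars (\<lambda>_. borel) Z {i, j}"
      using indep ij by (auto intro: indep_vars_subset)
    have "integrable M (\<lambda>\<omega>. \<Prod>k\<in>{i, j}. Z k \<omega>)"
      by (rule indep_vars_integrable[OF _ ind]) (use ij int in auto)
    moreover have "expectation (\<lambda>\<omega>. \<Prod>k\<in>{i, j}. Z k \<omega>) = (\<Prod>k\<in>{i, j}. expectation (Z k))"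
      by (rule indep_vars_lebesgue_integral[OF _ ind]) (use ij int in auto)
    ultimately show ?thesis using False mean ij by simp
  qed
  have sq: "(\<Sum>i\<in>I. Z i \<omega>)\<^sup>2 = (\<Sum>i\<in>I. \<Sum>j\<in>I. Z i \<omega> * Z j \<omega>)" for \<omega>
    by (simp add: power2_eq_square sum_product)
  show "integrable M (\<lambda>\<omega>. (\<Sum>i\<in>I. Z i \<omega>)\<^sup>2)"
    unfolding sq by (intro Bochner_Integration.integrable_sum) (use prod in blast)
  have "expectation (\<lambda>\<omega>. (\<Sum>i\<in>I. Z i \<omega>)\<^sup>2)
      = (\<Sum>i\<in>I. \<Sum>j\<in>I. expectation (\<lambda>\<omega>. Z i \<omega> * Z j \<omega>))"
    unfolding sq using prod
    by (subst Bochner_Integration.integral_sum) (auto intro!: Bochner_Integration.integrable_sum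
        sum.cong Bochner_Integration.integral_sum)
  also have "\<dots> = (\<Sum>i\<in>I. expectation (\<lambda>\<omega>. (Z i \<omega>)\<^sup>2))"
    using prod \<open>finite I\<close> by (intro sum.cong) auto
  finally show "expectation (\<lambda>\<omega>. (\<Sum>i\<in>I. Z i \<omega>)\<^sup>2) = (\<Sum>i\<in>I. expectation (\<lambda>\<omega>. (Z i \<omega>)\<^sup>2))" .
qed

lemma tendsto_average_partial_sums:
  fixes S :: "nat \<Rightarrow> 'b::real_normed_vector"
  assumes "(\<lambda>n. S n /\<^sub>R real n) \<longlonglongrightarrow> \<mu>"
  shows "(\<lambda>n. (\<Sum>i=1..n. S i) /\<^sub>R (real n)\<^sup>2) \<longlonglongrightarrow> \<mu> /\<^sub>R 2"
proof -
  define R where "R i = S i - real i *\<^sub>R \<mu>" for i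
  have small: "\<exists>C\<ge>0. \<forall>n\<ge>1. norm (\<Sum>i=1..n. R i) \<le> C * real n + e * (real n)\<^sup>2" if "e > 0" for e
  proof -
    obtain N where N: "\<And>n. n \<ge> N \<Longrightarrow> norm (S n /\<^sub>R real n - \<mu>) < e"
      using LIMSEQ_D[OF assms \<open>e > 0\<close>] by blast
    define C where "C = (\<Sum>i\<le>N. norm (R i))"
    have R: "norm (R i) \<le> C + e * real n" if "i \<in> {1..n}" for i n
    proof (cases "i \<le> N")
      case True
      then have "norm (R i) \<le> C"
        unfolding C_def by (intro member_le_sum) auto
      then show ?thesis using \<open>e > 0\<close> by (simp add: add_increasing2)
    next
      case False
      have "R i = real i *\<^sub>R (S i /\<^sub>R real i - \<mu>)"
        using that by (simp add: R_def scaleR_diff_right)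
      then have "norm (R i) = real i * norm (S i /\<^sub>R real i - \<mu>)" by simp
      also have "\<dots> \<le> real n * e"
        using N[of i] False that by (intro mult_mono) auto
      finally show ?thesis
        by (simp add: C_def mult.commute add_increasing sum_nonneg)
    qed
    have "norm (\<Sum>i=1..n. R i) \<le> C * real n + e * (real n)\<^sup>2" for n
    proof -
      have "norm (\<Sum>i=1..n. R i) \<le> (\<Sum>i=1..n. C + e * real n)"
        by (intro sum_norm_le R)
      then show ?thesis by (simp add: algebra_simps power2_eq_square)
    qed
    moreover have "C \<ge> 0" by (simp add: C_def sum_nonneg)
    ultimately show ?thesis by blast
  qed
  have R_lim: "(\<lambda>n. (\<Sum>i=1..n. R i) /\<^sub>R (real n)\<^sup>2) \<longlonglongrightarrow> 0"
  proof (rule tendstoI)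
    fix e :: real assume "e > 0"
    then obtain C where C: "\<And>n. n \<ge> 1 \<Longrightarrow> norm (\<Sum>i=1..n. R i) \<le> C * real n + e / 2 * (real n)\<^sup>2"
      using small[of "e / 2"] by auto
    have "(\<lambda>n. C / real n) \<longlonglongrightarrow> 0"
      by (rule lim_const_over_n)
    then have "eventually (\<lambda>n. C / real n < e / 2) sequentially"
      using \<open>e > 0\<close> by (intro order_tendstoD) auto
    then show "eventually (\<lambda>n. dist ((\<Sum>i=1..n. R i) /\<^sub>R (real n)\<^sup>2) 0 < e) sequentially"
      using eventually_ge_at_top[of 1]
    proof eventually_elim
      case (elim n)
      have "norm (\<Sum>i=1..n. R i) / (real n)\<^sup>2 \<le> (C * real n + e / 2 * (real n)\<^sup>2) / (real n)\<^sup>2"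
        using C[of n] elim by (intro divide_right_mono) auto
      also have "\<dots> = C / real n + e / 2"
        using elim by (simp add: field_simps power2_eq_square)
      also have "\<dots> < e / 2 + e / 2" using elim(1) by (rule add_strict_right_mono)
      also have "\<dots> = e" by simp
      finally show ?case by (simp add: divide_inverse mult.commute)
    qed
  qed
  have "(\<lambda>n. (1 / 2 + 1 / 2 * (1 / real n)) *\<^sub>R \<mu>) \<longlonglongrightarrow> (1 / 2 + 1 / 2 * 0) *\<^sub>R \<mu>"
    by (intro tendsto_intros lim_1_over_n)
  then have "(\<lambda>n. (\<Sum>i=1..n. R i) /\<^sub>R (real n)\<^sup>2 + (1 / 2 + 1 / 2 * (1 / real n)) *\<^sub>R \<mu>)
      \<longlonglongrightarrow> 0 + (1 / 2 + 1 / 2 * 0) *\<^sub>R \<mu>"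
    by (intro tendsto_add R_lim)
  moreover have "eventually (\<lambda>n. (\<Sum>i=1..n. R i) /\<^sub>R (real n)\<^sup>2 + (1 / 2 + 1 / 2 * (1 / real n)) *\<^sub>R \<mu>
      = (\<Sum>i=1..n. S i) /\<^sub>R (real n)\<^sup>2) sequentially"
    using eventually_ge_at_top[of 1]
  proof eventually_elim
    case (elim n)
    have "(\<Sum>i=1..n. real i) = real n * (real n + 1) / 2"
      by (induction n) (auto simp: field_simps)
    then have "(\<Sum>i=1..n. R i) = (\<Sum>i=1..n. S i) - (real n * (real n + 1) / 2) *\<^sub>R \<mu>"
      by (simp add: R_def sum_subtractf flip: scaleR_sum_left)
    moreover have "inverse ((real n)\<^sup>2) * (real n * (real n + 1) / 2) = 1 / 2 + 1 / 2 * (1 / real n)"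
      using elim by (simp add: field_simps power2_eq_square)
    ultimately show ?case
      by (simp only: scaleR_diff_right scaleR_scaleR diff_add_cancel)
  qed
  ultimately show ?thesis
    by (simp add: tendsto_cong inverse_eq_divide)
qed

lemma tendsto_center_of_mass:
  fixes x :: "nat \<Rightarrow> 'w \<Rightarrow> 'b::real_normed_vector"
  assumes lim: "(\<lambda>n. walk x n \<omega> /\<^sub>R real n) \<longlonglongrightarrow> \<mu>" and "t \<ge> 0"
  shows "(\<lambda>n. (1 / real n) *\<^sub>R center_of_mass x (nat \<lfloor>real n * t\<rfloor>) \<omega>) \<longlonglongrightarrow> (t / 2) *\<^sub>R \<mu>"
proof (cases "t = 0")
  case True
  then show ?thesis by (simp add: center_of_mass_def)
next
  case False
  with \<open>t \<ge> 0\<close> have "t > 0" by simp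
  define k where "k n = nat \<lfloor>real n * t\<rfloor>" for n
  have nt: "filterlim (\<lambda>n. real n * t) at_top sequentially"
    using \<open>t > 0\<close> by (intro filterlim_at_top_mult_tendsto_pos[OF tendsto_const _ filterlim_real_sequentially])
  then have k_lim: "filterlim k at_top sequentially"
    unfolding k_def
    by (intro filterlim_compose[OF filterlim_nat_sequentially]
        filterlim_compose[OF filterlim_floor_sequentially])
  have k_ratio: "(\<lambda>n. real (k n) / real n) \<longlonglongrightarrow> t"
  proof (rule tendsto_sandwich)
    show "(\<lambda>n. t - 1 / real n) \<longlonglongrightarrow> t" using tendsto_diff[OF tendsto_const lim_1_over_n, of t] by simp
    show "(\<lambda>n. t) \<longlonglongrightarrow> t" by simp
    have *: "real n * t - 1 \<le> real (k n)" "real (k n) \<le> real n * t" for n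
    proof -
      have "0 \<le> real n * t" using \<open>t > 0\<close> by simp
      then show "real n * t - 1 \<le> real (k n)" "real (k n) \<le> real n * t"
        unfolding k_def by linarith+
    qed
    show "eventually (\<lambda>n. t - 1 / real n \<le> real (k n) / real n) sequentially"
      using eventually_ge_at_top[of 1]
    proof eventually_elim
      case (elim n)
      then have "t - 1 / real n = (real n * t - 1) / real n" by (simp add: field_simps)
      also have "\<dots> \<le> real (k n) / real n" by (intro divide_right_mono *) simp
      finally show ?case .
    qed
    show "eventually (\<lambda>n. real (k n) / real n \<le> t) sequentially"
      using eventually_ge_at_top[of 1] by eventually_elim (use * in \<open>simp add: field_simps\<close>)
  qed
  have "(\<lambda>n. (real (k n) / real n) *\<^sub>R ((\<Sum>i=1..k n. walk x i \<omega>) /\<^sub>R (real (k n))\<^sup>2)) \<longlonglongrightarrow> t *\<^sub>R (\<mu> /\<^sub>R 2)"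
    by (intro tendsto_scaleR k_ratio filterlim_compose[OF tendsto_average_partial_sums[OF lim] k_lim])
  also have "(\<lambda>n. (real (k n) / real n) *\<^sub>R ((\<Sum>i=1..k n. walk x i \<omega>) /\<^sub>R (real (k n))\<^sup>2))
      = (\<lambda>n. (1 / real n) *\<^sub>R center_of_mass x (k n) \<omega>)"
    by (rule ext) (simp add: center_of_mass_def power2_eq_square divide_simps)
  also have "t *\<^sub>R (\<mu> /\<^sub>R 2) = (t / 2) *\<^sub>R \<mu>"
    by simp
  finally show ?thesis unfolding k_def .
qed

lemma (in prob_space) strong_law_nonneg_geometric:
  fixes X :: "nat \<Rightarrow> 'a \<Rightarrow> real" and Y :: "'a \<Rightarrow> real" and a :: real
  assumes [measurable]: "Y \<in> borel_measurable M"
    and indep: "indep_vars (\<lambda>_. borel) X {1..}"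
    and distr: "\<And>i. i \<ge> 1 \<Longrightarrow> distr M borel (X i) = distr M borel Y"
    and int: "integrable M Y"
    and nonneg: "\<And>i \<omega>. X i \<omega> \<ge> 0" "\<And>\<omega>. Y \<omega> \<ge> 0"
    and a: "a > 1"
  shows "AE \<omega> in M. (\<lambda>n. (\<Sum>i=1..nat \<lfloor>a ^ n\<rfloor>. X i \<omega>) / a ^ n) \<longlonglongrightarrow> expectation Y"
proof -
  have X_meas [measurable]: "X i \<in> borel_measurable M" if "i \<ge> 1" for i
    using indep that by (auto simp: indep_vars_def)
  have transfer_integral: "expectation (\<lambda>\<omega>. f (X i \<omega>)) = expectation (\<lambda>\<omega>. f (Y \<omega>))"
    if [measurable]: "f \<in> borel_measurable borel" and "i \<ge> 1" for f :: "real \<Rightarrow> real" and i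
    using integral_distr[of "X i" M borel f] integral_distr[of Y M borel f] that
    by (simp add: distr)
  have transfer_nn_integral: "(\<integral>\<^sup>+\<omega>. f (X i \<omega>) \<partial>M) = (\<integral>\<^sup>+\<omega>. f (Y \<omega>) \<partial>M)"
    if [measurable]: "f \<in> borel_measurable borel" and "i \<ge> 1" for f :: "real \<Rightarrow> ennreal" and i
    using nn_integral_distr[of "X i" M borel f] nn_integral_distr[of Y M borel f] that
    by (simp add: distr)

  have "AE \<omega> in M. (\<lambda>i. if real (Suc i) < X (Suc i) \<omega> then 1 else 0 :: real) \<longlonglongrightarrow> 0"
  proof (rule AE_tendsto_0_if_dominated_sums)
    show "(\<integral>\<^sup>+\<omega>. ennreal (if real (Suc i) < X (Suc i) \<omega> then 1 else 0) \<partial>M)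
        \<le> (\<integral>\<^sup>+\<omega>. ennreal (if real (Suc i) < Y \<omega> then 1 else 0) \<partial>M)" for i
      by (rule eq_refl, rule transfer_nn_integral[of "\<lambda>x. ennreal (if real (Suc i) < x then 1 else 0)"]) auto
    show "(\<Sum>i<N. if real (Suc i) < Y \<omega> then 1 else 0) \<le> Y \<omega>" for N \<omega>
      by (rule count_exceeded_le) (rule nonneg)
  qed (use int in auto)
  then have eventually_le: "AE \<omega> in M. eventually (\<lambda>i. X i \<omega> \<le> real i) sequentially"
  proof eventually_elim
    case (elim \<omega>)
    then have "eventually (\<lambda>i. (if real (Suc i) < X (Suc i) \<omega> then 1 else 0 :: real) < 1) sequentially"
      by (intro order_tendstoD) auto
    then have "eventually (\<lambda>i. X (Suc i) \<omega> \<le> real (Suc i)) sequentially"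
      by eventually_elim (auto split: if_splits)
    then show ?case by (subst (asm) eventually_sequentially_Suc)
  qed

  have pow_lim: "filterlim (\<lambda>n. a ^ n) at_top sequentially"
    using filterlim_at_infinity_imp_filterlim_at_top[OF filterlim_realpow_sequentially_gt1[of a]] a
    by simp
  define f where "f n x = (if x \<le> a ^ n then x else 0)" for n and x :: real
  have f_meas [measurable]: "f n \<in> borel_measurable borel" for n
    unfolding f_def by measurable
  have f_bounds: "0 \<le> f n x" "f n x \<le> x" "f n x \<le> a ^ n" if "x \<ge> 0" for n x
    using that a by (auto simp: f_def)
  define k where "k n = nat \<lfloor>a ^ n\<rfloor>" for n
  have k_le: "real (k n) \<le> a ^ n" and k_gt: "a ^ n - 1 < real (k n)" for n
  proof -
    have "0 \<le> a ^ n" using a by simp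
    then show "real (k n) \<le> a ^ n" "a ^ n - 1 < real (k n)"
      unfolding k_def by linarith+
  qed
  define m where "m n = expectation (\<lambda>\<omega>. f n (Y \<omega>))" for n
  have m_lim: "m \<longlonglongrightarrow> expectation Y"
    unfolding m_def
  proof (rule integral_dominated_convergence[where w = Y])
    have "(\<lambda>n. f n (Y \<omega>)) \<longlonglongrightarrow> Y \<omega>" for \<omega>
    proof (rule tendsto_eventually)
      have "eventually (\<lambda>n. Y \<omega> \<le> a ^ n) sequentially"
        using pow_lim by (simp add: filterlim_at_top)
      then show "eventually (\<lambda>n. f n (Y \<omega>) = Y \<omega>) sequentially"
        by eventually_elim (simp add: f_def)
    qed
    then show "AE \<omega> in M. (\<lambda>n. f n (Y \<omega>)) \<longlonglongrightarrow> Y \<omega>" by simp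
  qed (use int f_bounds nonneg(2) in \<open>simp_all add: borel_measurable_integrable\<close>)

  have second_moment: "(\<integral>\<^sup>+\<omega>. ennreal (((\<Sum>i=1..k n. f n (X i \<omega>) - m n) / a ^ n)\<^sup>2) \<partial>M)
      \<le> (\<integral>\<^sup>+\<omega>. ennreal ((f n (Y \<omega>))\<^sup>2 / a ^ n) \<partial>M)" for n
  proof -
    define Z where "Z i \<omega> = f n (X i \<omega>) - m n" for i \<omega>
    have ind: "indep_vars (\<lambda>_. borel) Z {1..k n}"
      unfolding Z_def by (intro indep_vars_compose2[OF indep_vars_subset[OF indep]]) auto
    have trunc_int: "integrable M (\<lambda>\<omega>. f n (V \<omega>))" "integrable M (\<lambda>\<omega>. (f n (V \<omega>))\<^sup>2)"
      if [measurable]: "V \<in> borel_measurable M" and V: "\<And>\<omega>. V \<omega> \<ge> 0" for V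
    proof -
      show "integrable M (\<lambda>\<omega>. f n (V \<omega>))"
        by (rule integrable_const_bound[where B = "a ^ n"]) (simp_all add: f_bounds V)
      show "integrable M (\<lambda>\<omega>. (f n (V \<omega>))\<^sup>2)"
        by (rule integrable_const_bound[where B = "(a ^ n)\<^sup>2"]) (simp_all add: f_bounds V power_mono)
    qed
    note Y_int = trunc_int[OF _ nonneg(2)]
    note X_int = trunc_int[OF X_meas nonneg(1)]
    have Z_int: "integrable M (Z i)" "integrable M (\<lambda>\<omega>. (Z i \<omega>)\<^sup>2)" and Z_mean: "expectation (Z i) = 0"
      and Z_var: "expectation (\<lambda>\<omega>. (Z i \<omega>)\<^sup>2) \<le> expectation (\<lambda>\<omega>. (f n (Y \<omega>))\<^sup>2)"
      if i: "i \<in> {1..k n}" for i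
    proof -
      have mean: "expectation (\<lambda>\<omega>. f n (X i \<omega>)) = m n"
        unfolding m_def using i by (intro transfer_integral) auto
      show "integrable M (Z i)"
        unfolding Z_def using X_int i by simp
      show "integrable M (\<lambda>\<omega>. (Z i \<omega>)\<^sup>2)"
        unfolding Z_def power2_diff using X_int i by simp
      show "expectation (Z i) = 0"
        unfolding Z_def using X_int i by (simp add: mean prob_space)
      have "expectation (\<lambda>\<omega>. (Z i \<omega>)\<^sup>2) \<le> expectation (\<lambda>\<omega>. (f n (X i \<omega>))\<^sup>2)"
        unfolding Z_def mean[symmetric] using X_int i by (subst variance_eq) auto
      also have "\<dots> = expectation (\<lambda>\<omega>. (f n (Y \<omega>))\<^sup>2)"
        using i by (intro transfer_integral[of "\<lambda>x. (f n x)\<^sup>2"]) auto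
      finally show "expectation (\<lambda>\<omega>. (Z i \<omega>)\<^sup>2) \<le> expectation (\<lambda>\<omega>. (f n (Y \<omega>))\<^sup>2)" .
    qed
    note sum_Z = expectation_sum_squared_indep[OF _ ind Z_int Z_mean, simplified]
    have "expectation (\<lambda>\<omega>. ((\<Sum>i=1..k n. Z i \<omega>) / a ^ n)\<^sup>2)
        = (\<Sum>i=1..k n. expectation (\<lambda>\<omega>. (Z i \<omega>)\<^sup>2)) / (a ^ n)\<^sup>2"
      by (simp add: power_divide sum_Z)
    also have "\<dots> \<le> (\<Sum>i=1..k n. expectation (\<lambda>\<omega>. (f n (Y \<omega>))\<^sup>2)) / (a ^ n)\<^sup>2"
      by (intro divide_right_mono sum_mono Z_var) auto
    also have "\<dots> \<le> a ^ n * expectation (\<lambda>\<omega>. (f n (Y \<omega>))\<^sup>2) / (a ^ n)\<^sup>2"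
      using k_le by (auto intro!: divide_right_mono mult_right_mono)
    also have "\<dots> = expectation (\<lambda>\<omega>. (f n (Y \<omega>))\<^sup>2 / a ^ n)"
      using a by (simp add: power2_eq_square)
    finally have "expectation (\<lambda>\<omega>. ((\<Sum>i=1..k n. Z i \<omega>) / a ^ n)\<^sup>2)
        \<le> expectation (\<lambda>\<omega>. (f n (Y \<omega>))\<^sup>2 / a ^ n)" .
    then have "(\<integral>\<^sup>+\<omega>. ennreal (((\<Sum>i=1..k n. Z i \<omega>) / a ^ n)\<^sup>2) \<partial>M)
        \<le> (\<integral>\<^sup>+\<omega>. ennreal ((f n (Y \<omega>))\<^sup>2 / a ^ n) \<partial>M)"
      using a sum_Z(1) Y_int[OF assms(1)]
      by (subst (1 2) nn_integral_eq_integral) (simp_all add: power_divide ennreal_leI)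
    then show ?thesis by (simp add: Z_def)
  qed
  have "AE \<omega> in M. (\<lambda>n. ((\<Sum>i=1..k n. f n (X i \<omega>) - m n) / a ^ n)\<^sup>2) \<longlonglongrightarrow> 0"
  proof (rule AE_tendsto_0_if_dominated_sums[where h = "\<lambda>n \<omega>. (f n (Y \<omega>))\<^sup>2 / a ^ n", OF _ _ _ _ second_moment])
    show "integrable M (\<lambda>\<omega>. a / (a - 1) * Y \<omega>)" using int by simp
    show "(\<Sum>n<N. (f n (Y \<omega>))\<^sup>2 / a ^ n) \<le> a / (a - 1) * Y \<omega>" for N \<omega>
      unfolding f_def using a nonneg(2) by (rule truncated_geometric_sum_le)
    show "(\<lambda>\<omega>. ((\<Sum>i=1..k n. f n (X i \<omega>) - m n) / a ^ n)\<^sup>2) \<in> borel_measurable M" for n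
    proof -
      have "(\<lambda>\<omega>. f n (X i \<omega>)) \<in> borel_measurable M" if "i \<in> {1..k n}" for i
        by (rule measurable_compose[OF X_meas f_meas]) (use that in simp)
      then show ?thesis
        by (intro borel_measurable_power borel_measurable_divide borel_measurable_sum borel_measurable_diff
            borel_measurable_const)
    qed
    show "(\<lambda>\<omega>. (f n (Y \<omega>))\<^sup>2 / a ^ n) \<in> borel_measurable M" for n
      by measurable
    show "0 \<le> (f n (Y \<omega>))\<^sup>2 / a ^ n" for n \<omega>
      using a by simp
  qed simp
  with eventually_le show ?thesis
  proof eventually_elim
    case (elim \<omega>)
    have k_ratio: "(\<lambda>n. real (k n) / a ^ n) \<longlonglongrightarrow> 1"
    proof (rule tendsto_sandwich)
      have "(\<lambda>n. 1 - (1 / a) ^ n) \<longlonglongrightarrow> 1 - 0"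
        using a by (intro tendsto_intros LIMSEQ_realpow_zero) auto
      then show "(\<lambda>n. 1 - (1 / a) ^ n) \<longlonglongrightarrow> 1" by simp
      show "(\<lambda>n. 1) \<longlonglongrightarrow> (1 :: real)" by simp
      have "1 - (1 / a) ^ n \<le> real (k n) / a ^ n" for n
      proof -
        have "1 - (1 / a) ^ n = (a ^ n - 1) / a ^ n"
          using a by (simp add: power_one_over diff_divide_distrib)
        also have "\<dots> \<le> real (k n) / a ^ n"
          using a k_gt[of n] by (intro divide_right_mono) auto
        finally show ?thesis .
      qed
      then show "eventually (\<lambda>n. 1 - (1 / a) ^ n \<le> real (k n) / a ^ n) sequentially" by simp
      have "real (k n) / a ^ n \<le> 1" for n
        using a k_le[of n] by simp
      then show "eventually (\<lambda>n. real (k n) / a ^ n \<le> 1) sequentially" by simp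
    qed
    have "(\<lambda>n. (\<Sum>i=1..k n. f n (X i \<omega>) - m n) / a ^ n) \<longlonglongrightarrow> 0"
    proof (rule tendsto_rabs_zero_cancel)
      show "(\<lambda>n. \<bar>(\<Sum>i=1..k n. f n (X i \<omega>) - m n) / a ^ n\<bar>) \<longlonglongrightarrow> 0"
        using tendsto_real_sqrt[OF elim(2)] by (simp only: real_sqrt_abs real_sqrt_zero)
    qed
    then have "(\<lambda>n. (\<Sum>i=1..k n. f n (X i \<omega>) - m n) / a ^ n + real (k n) / a ^ n * m n)
        \<longlonglongrightarrow> 0 + 1 * expectation Y"
      by (intro tendsto_intros k_ratio m_lim)
    then have lim: "(\<lambda>n. (\<Sum>i=1..k n. f n (X i \<omega>)) / a ^ n) \<longlonglongrightarrow> expectation Y"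
      by (simp add: sum_subtractf diff_divide_distrib)
    obtain i0 where i0: "\<And>i. i \<ge> i0 \<Longrightarrow> X i \<omega> \<le> real i"
      using elim(1) by (auto simp: eventually_sequentially)
    have "eventually (\<lambda>n. \<forall>i\<in>{..i0}. X i \<omega> \<le> a ^ n) sequentially"
      using pow_lim by (intro eventually_ball_finite) (auto simp: filterlim_at_top)
    then have "eventually (\<lambda>n. (\<Sum>i=1..k n. f n (X i \<omega>)) / a ^ n = (\<Sum>i=1..k n. X i \<omega>) / a ^ n) sequentially"
    proof eventually_elim
      case (elim n)
      have "X i \<omega> \<le> a ^ n" if "i \<in> {1..k n}" for i
      proof (cases "i \<le> i0")
        case True
        then show ?thesis using elim by simp
      next
        case False
        then show ?thesis using i0[of i] k_le[of n] that by (auto intro: order_trans)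
      qed
      then show ?case by (simp add: f_def)
    qed
    with lim show ?case
      unfolding k_def by (rule Lim_transform_eventually)
  qed
qed

lemma (in prob_space) strong_law_nonneg:
  fixes X :: "nat \<Rightarrow> 'a \<Rightarrow> real" and Y :: "'a \<Rightarrow> real"
  assumes "Y \<in> borel_measurable M"
    and "indep_vars (\<lambda>_. borel) X {1..}"
    and "\<And>i. i \<ge> 1 \<Longrightarrow> distr M borel (X i) = distr M borel Y"
    and "integrable M Y"
    and nonneg: "\<And>i \<omega>. X i \<omega> \<ge> 0" "\<And>\<omega>. Y \<omega> \<ge> 0"
  shows "AE \<omega> in M. (\<lambda>n. (\<Sum>i=1..n. X i \<omega>) / real n) \<longlonglongrightarrow> expectation Y"
proof -
  have "AE \<omega> in M. \<forall>m. (\<lambda>n. (\<Sum>i=1..nat \<lfloor>(1 + 1 / real (Suc m)) ^ n\<rfloor>. X i \<omega>) / (1 + 1 / real (Suc m)) ^ n)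
      \<longlonglongrightarrow> expectation Y"
    unfolding AE_all_countable
    by (intro allI strong_law_nonneg_geometric assms) (auto simp del: of_nat_Suc)
  then show ?thesis
  proof eventually_elim
    case (elim \<omega>)
    show ?case
    proof (rule tendsto_average_if_geometric_subsequences[OF _ _ elim[rule_format]])
      show "mono (\<lambda>n. \<Sum>i=1..n. X i \<omega>)"
        by (intro monoI sum_mono2) (auto simp: nonneg)
    qed (simp add: sum_nonneg nonneg)
  qed
qed

lemma distr_compose_cong:
  assumes "U \<in> measurable M N" "V \<in> measurable M N" "distr M N U = distr M N V" "f \<in> measurable N L"
  shows "distr M L (\<lambda>\<omega>. f (U \<omega>)) = distr M L (\<lambda>\<omega>. f (V \<omega>))"
  using assms distr_distr[of f N L U M] distr_distr[of f N L V M] by (simp add: comp_def)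

theorem (in prob_space) strong_law_real:
  fixes X :: "nat \<Rightarrow> 'a \<Rightarrow> real" and Y :: "'a \<Rightarrow> real"
  assumes [measurable]: "Y \<in> borel_measurable M"
    and indep: "indep_vars (\<lambda>_. borel) X {1..}"
    and distr: "\<And>i. i \<ge> 1 \<Longrightarrow> distr M borel (X i) = distr M borel Y"
    and int: "integrable M Y"
  shows "AE \<omega> in M. (\<lambda>n. (\<Sum>i=1..n. X i \<omega>) / real n) \<longlonglongrightarrow> expectation Y"
proof -
  have X_meas: "X i \<in> borel_measurable M" if "i \<ge> 1" for i
    using indep that by (auto simp: indep_vars_def)
  have part: "AE \<omega> in M. (\<lambda>n. (\<Sum>i=1..n. max 0 (s * X i \<omega>)) / real n) \<longlonglongrightarrow> expectation (\<lambda>\<omega>. max 0 (s * Y \<omega>))"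
    for s :: real
  proof (rule strong_law_nonneg)
    show "indep_vars (\<lambda>_. borel) (\<lambda>i \<omega>. max 0 (s * X i \<omega>)) {1..}"
      by (rule indep_vars_compose2[OF indep]) auto
    show "distr M borel (\<lambda>\<omega>. max 0 (s * X i \<omega>)) = distr M borel (\<lambda>\<omega>. max 0 (s * Y \<omega>))" if "i \<ge> 1" for i
      by (rule distr_compose_cong[where f = "\<lambda>x. max 0 (s * x)"]) (use that distr X_meas in auto)
  qed (use int in auto)
  have decomp: "max 0 (1 * x) - max 0 (- 1 * x) = x" for x :: real
    by simp
  show ?thesis
    using part[of 1] part[of "- 1"]
  proof eventually_elim
    case (elim \<omega>)
    have "(\<lambda>n. (\<Sum>i=1..n. max 0 (1 * X i \<omega>) - max 0 (- 1 * X i \<omega>)) / real n)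
        \<longlonglongrightarrow> expectation (\<lambda>\<omega>. max 0 (1 * Y \<omega>)) - expectation (\<lambda>\<omega>. max 0 (- 1 * Y \<omega>))"
      unfolding sum_subtractf diff_divide_distrib by (rule tendsto_diff[OF elim])
    also have "expectation (\<lambda>\<omega>. max 0 (1 * Y \<omega>)) - expectation (\<lambda>\<omega>. max 0 (- 1 * Y \<omega>))
        = expectation (\<lambda>\<omega>. max 0 (1 * Y \<omega>) - max 0 (- 1 * Y \<omega>))"
      using int by (intro Bochner_Integration.integral_diff[symmetric]) auto
    finally show ?case unfolding decomp .
  qed
qed

theorem (in prob_space) strong_law_vec:
  fixes X :: "nat \<Rightarrow> 'a \<Rightarrow> real ^ 'd" and Y :: "'a \<Rightarrow> real ^ 'd"
  assumes Y: "Y \<in> borel_measurable M"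
    and indep: "indep_vars (\<lambda>_. borel) X {1..}"
    and distr: "\<And>i. i \<ge> 1 \<Longrightarrow> distr M borel (X i) = distr M borel Y"
    and int: "integrable M Y"
  shows "AE \<omega> in M. (\<lambda>n. (\<Sum>i=1..n. X i \<omega>) /\<^sub>R real n) \<longlonglongrightarrow> expectation Y"
proof -
  have X_meas: "X i \<in> borel_measurable M" if "i \<ge> 1" for i
    using indep that by (auto simp: indep_vars_def)
  have nth_meas: "(\<lambda>x :: real ^ 'd. x $ j) \<in> borel_measurable borel" for j
    by (intro borel_measurable_continuous_onI continuous_intros)
  have "AE \<omega> in M. \<forall>j. (\<lambda>n. (\<Sum>i=1..n. X i \<omega> $ j) / real n) \<longlonglongrightarrow> expectation (\<lambda>\<omega>. Y \<omega> $ j)"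
    unfolding AE_all_countable
  proof (intro allI strong_law_real)
    fix j
    show "(\<lambda>\<omega>. Y \<omega> $ j) \<in> borel_measurable M"
      by (rule measurable_compose[OF Y nth_meas])
    show "indep_vars (\<lambda>_. borel) (\<lambda>i \<omega>. X i \<omega> $ j) {1..}"
      by (rule indep_vars_compose2[OF indep nth_meas])
    show "distr M borel (\<lambda>\<omega>. X i \<omega> $ j) = distr M borel (\<lambda>\<omega>. Y \<omega> $ j)" if "i \<ge> 1" for i
      by (rule distr_compose_cong[OF X_meas[OF that] Y distr[OF that] nth_meas])
    show "integrable M (\<lambda>\<omega>. Y \<omega> $ j)"
      by (rule integrable_bounded_linear[OF bounded_linear_vec_nth int])
  qed
  then show ?thesis
  proof eventually_elim
    case (elim \<omega>)
    have "expectation Y $ j = expectation (\<lambda>\<omega>. Y \<omega> $ j)" for j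
      by (rule integral_bounded_linear[OF bounded_linear_vec_nth int, symmetric])
    with elim show ?case
      by (intro vec_tendstoI) (simp add: divide_inverse mult.commute)
  qed
qed

theorem theorem7p1:
  fixes M :: "'w measure"
    and \<xi> :: "'w \<Rightarrow> real ^ 'd"
    and X :: "nat \<Rightarrow> 'w \<Rightarrow> real ^ 'd"
    and \<mu> :: "real ^ 'd"
    and t :: real
  assumes "prob_space M"
    and "\<xi> \<in> borel_measurable M"
    and "prob_space.indep_vars M (\<lambda>_. borel) X {1..}"
    and "\<And>i. i \<ge> 1 \<Longrightarrow> distr M borel (X i) = distr M borel \<xi>"
    and "integrable M (\<lambda>\<omega>. norm (\<xi> \<omega>))"
    and "(LINT \<omega>|M. \<xi> \<omega>) = \<mu>"
    and "0 \<le> t" and "t \<le> 1"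
  shows "AE \<omega> in M.
    (\<lambda>n. (1 / real n) *\<^sub>R center_of_mass X (nat \<lfloor>real n * t\<rfloor>) \<omega>) \<longlonglongrightarrow> (t / 2) *\<^sub>R \<mu>"
proof -
  interpret prob_space M by fact
  have "integrable M \<xi>"
    using assms(5,2) by (rule integrable_norm_cancel)
  then have "AE \<omega> in M. (\<lambda>n. walk X n \<omega> /\<^sub>R real n) \<longlonglongrightarrow> \<mu>"
    unfolding walk_def assms(6)[symmetric] by (intro strong_law_vec assms(2-4))
  then show ?thesis
    by eventually_elim (rule tendsto_center_of_mass[OF _ \<open>0 \<le> t\<close>])
qed

end
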